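(* Let $f$ be a probability measure on $\mathbb{R}$ with $\int_{\mathbb{R}} x^2 f(dx)=1$, and let $(F^N)_{N\in\mathbb{N}}$, with $F^N$ a symmetric probability measure on $\mathbb{R}^N$, be a sequence that is Kac chaotic to $f$. Assume that no $F^N$ has an atom at the origin of $\mathbb{R}^N$, and that $\sup_N \int_{\mathbb{R}^N} |x_1|^p F^N(dx)<\infty$ for some $p>4$. Then the sequence of rescaled measures $(\hat F^N)_{N\in\mathbb{N}}$ is Kac chaotic to $f$.
   Context: Kac chaos: a sequence $(F^N)_{N}$, where $F^N$ is a probability measure on $\mathbb{R}^N$ invariant under permutations of the coordinates, is Kac chaotic to a probability measure $f$ on $\mathbb{R}$ if for every $k\in\mathbb{N}$ the marginal of $F^N$ on its first $k$ coordinates converges weakly to $f^{\otimes k}$ as $N\to\infty$. Kac's sphere is $S^{N-1}=\{x\in\mathbb{R}^N:\sum_i x_i^2=N\}$. For $x\in\mathbb{R}^N\setminus\{0\}$ put $\hat x=\frac{\sqrt N}{|x|}x\in S^{N-1}$, where $|\cdot|$ is the Euclidean norm. For a probability measure $F^N$ on $\mathbb{R}^N$ without an atom at the origin, the rescaled measure $\hat F^N$ is the push-forward of $F^N$ under $x\mapsto\hat x$; it is a probability measure on $S^{N-1}$, viewed also as a probability measure on $\mathbb{R}^N$. *)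

theory Defs
  imports "HOL-Probability.Probability"
begin

(* Points of R^N are the extensional functions {..<N} \<rightarrow> real, i.e. coordinates are numbered
   from 0 and the value outside {..<N} is always undefined. *)

abbreviation borel_Rn :: "nat \<Rightarrow> (nat \<Rightarrow> real) measure" where
  "borel_Rn N \<equiv> PiM {..<N} (\<lambda>_. borel)"

definition prob_measure_Rn :: "nat \<Rightarrow> (nat \<Rightarrow> real) measure \<Rightarrow> bool" where
  "prob_measure_Rn N \<mu> \<longleftrightarrow> prob_space \<mu> \<and> sets \<mu> = sets (borel_Rn N)"

definition symmetric_Rn :: "nat \<Rightarrow> (nat \<Rightarrow> real) measure \<Rightarrow> bool" where
  "symmetric_Rn N \<mu> \<longleftrightarrow>
     (\<forall>\<pi>. \<pi> permutes {..<N} \<longrightarrow> distr \<mu> (borel_Rn N) (\<lambda>x. \<lambda>i\<in>{..<N}. x (\<pi> i)) = \<mu>)"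

(* The finite product topology on PiE {..<k} UNIV is the usual topology of R^k. *)

definition weak_conv_Rn ::
  "nat \<Rightarrow> (nat \<Rightarrow> (nat \<Rightarrow> real) measure) \<Rightarrow> (nat \<Rightarrow> real) measure \<Rightarrow> bool" where
  "weak_conv_Rn k \<mu> \<nu> \<longleftrightarrow>
     (\<forall>g. continuous_map (product_topology (\<lambda>_. euclideanreal) {..<k}) euclideanreal g
          \<and> bounded (g ` (PiE {..<k} (\<lambda>_. UNIV)))
        \<longrightarrow> (\<lambda>n. \<integral>x. g x \<partial>\<mu> n) \<longlonglongrightarrow> (\<integral>x. g x \<partial>\<nu>))"

(* Meaningful for k \<le> N only; when N tends to infinity the other values play no role. *)

definition marginal_Rn :: "nat \<Rightarrow> (nat \<Rightarrow> real) measure \<Rightarrow> (nat \<Rightarrow> real) measure" where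
  "marginal_Rn k \<mu> = distr \<mu> (borel_Rn k) (\<lambda>x. restrict x {..<k})"

(* Sequences of measures start at N = 1; the value at N = 0 is ignored. *)

definition Kac_chaotic :: "(nat \<Rightarrow> (nat \<Rightarrow> real) measure) \<Rightarrow> real measure \<Rightarrow> bool" where
  "Kac_chaotic F f \<longleftrightarrow>
     (\<forall>N\<ge>1. prob_measure_Rn N (F N) \<and> symmetric_Rn N (F N)) \<and>
     (\<forall>k\<ge>1. weak_conv_Rn k (\<lambda>N. marginal_Rn k (F N)) (PiM {..<k} (\<lambda>_. f)))"

(* L2_set x {..<N} is the Euclidean norm of x. The origin is sent to itself (division by 0). *)

definition sphere_rescale :: "nat \<Rightarrow> (nat \<Rightarrow> real) \<Rightarrow> (nat \<Rightarrow> real)" where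
  "sphere_rescale N x = (\<lambda>i\<in>{..<N}. sqrt (real N) / L2_set x {..<N} * x i)"

definition rescaled_measure :: "nat \<Rightarrow> (nat \<Rightarrow> real) measure \<Rightarrow> (nat \<Rightarrow> real) measure" where
  "rescaled_measure N \<mu> = distr \<mu> (borel_Rn N) (sphere_rescale N)"

definition origin_Rn :: "nat \<Rightarrow> (nat \<Rightarrow> real)" where
  "origin_Rn N = (\<lambda>i\<in>{..<N}. 0)"

lemma sphere_rescale_on_sphere:
  assumes "x \<in> space (borel_Rn N)" "x \<noteq> origin_Rn N"
  shows "(\<Sum>i<N. (sphere_rescale N x i)\<^sup>2) = real N"
proof -
  have "\<exists>i<N. x i \<noteq> 0"
  proof (rule ccontr)
    assume "\<not> (\<exists>i<N. x i \<noteq> 0)"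
    hence "x = origin_Rn N"
      using assms(1) by (auto simp: origin_Rn_def space_PiM PiE_def extensional_def fun_eq_iff)
    thus False using assms(2) by simp
  qed
  then obtain i where "i < N" "x i \<noteq> 0" by blast
  hence pos: "(\<Sum>i<N. (x i)\<^sup>2) > 0"
    by (intro sum_pos2[of _ i]) auto
  have "(\<Sum>i<N. (sphere_rescale N x i)\<^sup>2) = (\<Sum>i<N. real N / (\<Sum>i<N. (x i)\<^sup>2) * (x i)\<^sup>2)"
    using pos by (intro sum.cong)
      (auto simp: sphere_rescale_def L2_set_def power_mult_distrib power_divide)
  also have "\<dots> = real N"
    using pos by (simp add: sum_distrib_left[symmetric] sum_divide_distrib[symmetric])
  finally show ?thesis .
qed

lemma sphere_rescale_measurable: "sphere_rescale N \<in> borel_Rn N \<rightarrow>\<^sub>M borel_Rn N"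
  unfolding sphere_rescale_def L2_set_def by measurable

end

(* Only |x|^2/N \<rightarrow> 1 in mean square is needed: then, on the likely event where the first k coordinates
   are bounded and |x|^2/N is close to 1, uniform continuity of a test function on compact boxes shows
   that rescaling the first k coordinates changes it little, and Chebyshev controls the rest. By symmetry
     E (|x|^2/N - 1)^2 = E x_1^4 / N + (1 - 1/N) E (x_1^2 x_2^2) - 2 E x_1^2 + 1,
   and the p-th moment bound with p > 4 makes x_1^2 and x_1^2 x_2^2 uniformly integrable, so that chaos
   of order 1 and 2 gives E x_1^2 \<rightarrow> 1 and E (x_1^2 x_2^2) \<rightarrow> 1. *)

theory Submission
  imports Defs
begin

section \<open>Continuous test functions on \<open>R^k\<close>: measurability and uniform
  continuity\<close>

text \<open>Restriction to the first \<open>k\<close> coordinates is continuous from the full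
  function space, so \<open>g\<close> may be handled as a function on the topological type
  \<open>nat \<Rightarrow> real\<close>, where \<open>continuous_on\<close>, \<open>compact\<close>
  and \<open>borel\<close> are available.\<close>

lemma continuous_on_restrict_Rn:
  fixes g :: "(nat \<Rightarrow> real) \<Rightarrow> real"
  assumes "continuous_map (product_topology (\<lambda>_. euclideanreal) {..<k}) euclideanreal g"
  shows "continuous_on UNIV (\<lambda>x. g (restrict x {..<k}))"
proof -
  have "continuous_map euclidean (product_topology (\<lambda>_. euclideanreal) {..<k})
          (\<lambda>x :: nat \<Rightarrow> real. restrict x {..<k})"
    by (auto simp: continuous_map_componentwise extensional_def)
  from continuous_map_compose[OF this assms] show ?thesis
    by (simp add: o_def)
qed

text \<open>The points of \<open>borel_Rn k\<close> are undefined beyond \<open>k\<close>, so they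
  are padded with zeros to reach \<open>nat \<Rightarrow> real\<close>. There \<open>g\<close> after
  restriction is continuous, hence Borel, and restricting the padded point gives the original point
  back.\<close>

lemma borel_measurable_continuous_map_Rn:
  fixes g :: "(nat \<Rightarrow> real) \<Rightarrow> real"
  assumes "continuous_map (product_topology (\<lambda>_. euclideanreal) {..<k}) euclideanreal g"
  shows "g \<in> borel_measurable (borel_Rn k)"
proof -
  have "(\<lambda>x i. if i < k then x i else 0) \<in> borel_Rn k \<rightarrow>\<^sub>M PiM UNIV (\<lambda>_. borel :: real measure)"
  proof (rule measurable_PiM_single')
    fix i
    show "(\<lambda>x. if i < k then x i else 0) \<in> borel_measurable (borel_Rn k)"
      by (cases "i < k") (auto intro: measurable_component_singleton)
  qed (auto simp: space_PiM)
  \<comment> \<open>With countably many coordinates the product sigma-algebra over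
    \<open>UNIV\<close> is the Borel sigma-algebra of the function space.\<close>
  hence "(\<lambda>x i. if i < k then x i else 0 :: real) \<in> borel_Rn k \<rightarrow>\<^sub>M borel"
    by (simp add: measurable_def sets_PiM_equal_borel space_PiM)
  from measurable_compose[OF this borel_measurable_continuous_onI
      [OF continuous_on_restrict_Rn[OF assms]]]
  have "(\<lambda>x. g (restrict (\<lambda>i. if i < k then x i else 0) {..<k})) \<in> borel_measurable (borel_Rn k)" .
  moreover have "restrict (\<lambda>i. if i < k then x i else 0) {..<k} = x"
    if "x \<in> space (borel_Rn k)" for x :: "nat \<Rightarrow> real"
    using that by (auto simp: space_PiM PiE_def extensional_def fun_eq_iff)
  ultimately show ?thesis by (simp cong: measurable_cong)
qed

text \<open>The dilation factor is treated as one more variable: \<open>H\<close> is jointly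
  continuous in the pair \<open>(s, x)\<close> on a compact set, hence uniformly continuous there,
  and comparing \<open>(s, x)\<close> with \<open>(1, x)\<close> gives a \<open>d\<close> that does
  not depend on \<open>x\<close>. In the application \<open>s\<close> is |x|^2/N.\<close>

lemma uniform_continuity_dilation:
  fixes g :: "(nat \<Rightarrow> real) \<Rightarrow> real"
  assumes "continuous_map (product_topology (\<lambda>_. euclideanreal) {..<k}) euclideanreal g"
    and "0 < e"
  obtains d where "0 < d"
    and "\<And>s x. \<bar>s - 1\<bar> < d \<Longrightarrow> (\<And>i. i < k \<Longrightarrow> \<bar>x i\<bar> \<le> R) \<Longrightarrow>
           \<bar>g (\<lambda>i\<in>{..<k}. x i / sqrt s) - g (restrict x {..<k})\<bar> < e"
proof -
  \<comment> \<open>The box has a side for every natural number and is compact by Tychonoff. The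
    bound \<open>max R 0\<close> makes each side contain 0, the value used below to pad coordinates
    from \<open>k\<close> on.\<close>
  define K where "K = (Pi UNIV (\<lambda>_. {- max R 0..max R 0}) :: (nat \<Rightarrow> real) set)"
  define H where "H = (\<lambda>z :: real \<times> (nat \<Rightarrow> real). g (\<lambda>i\<in>{..<k}. snd z i / sqrt (fst z)))"
  have "compactin (product_topology (\<lambda>_. euclideanreal) UNIV) (PiE UNIV (\<lambda>_. {- max R 0..max R 0}))"
    by (simp add: compactin_PiE)
  hence "compact K"
    by (simp add: K_def PiE_UNIV_domain euclidean_product_topology flip: compactin_euclidean_iff)
  hence "compact ({1/2..3/2 :: real} \<times> K)" by (intro compact_Times) auto
  moreover have "continuous_on ({1/2..3/2 :: real} \<times> K) H"
    unfolding H_def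
  proof (rule continuous_on_compose2[OF continuous_on_restrict_Rn[OF assms(1)]])
    show "continuous_on ({1/2..3/2 :: real} \<times> K) (\<lambda>z i. snd z i / sqrt (fst z))"
    proof (rule continuous_on_coordinatewise_then_product)
      fix i
      have "continuous_on UNIV (\<lambda>z :: real \<times> (nat \<Rightarrow> real). snd z i)"
        by (rule continuous_on_compose2[OF continuous_on_product_coordinates])
           (auto intro: continuous_intros)
      hence "continuous_on ({1/2..3/2 :: real} \<times> K) (\<lambda>z. snd z i)"
        by (rule continuous_on_subset) simp
      thus "continuous_on ({1/2..3/2 :: real} \<times> K) (\<lambda>z. snd z i / sqrt (fst z))"
        by (intro continuous_on_divide continuous_on_real_sqrt continuous_on_fst continuous_on_id) auto
    qed
  qed auto
  ultimately have "uniformly_continuous_on ({1/2..3/2 :: real} \<times> K) H"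
    by (rule compact_uniformly_continuous[rotated])
  then obtain d where d: "0 < d"
    "\<And>z w. \<lbrakk>z \<in> {1/2..3/2 :: real} \<times> K; w \<in> {1/2..3/2} \<times> K; dist w z < d\<rbrakk> \<Longrightarrow> dist (H w) (H z) < e"
    using assms(2) unfolding uniformly_continuous_on_def by metis
  show thesis
  proof
    \<comment> \<open>The cap 1/2 keeps \<open>s\<close> in [1/2, 3/2], away from the singularity of
      1 / sqrt s at 0.\<close>
    show "0 < min d (1/2)" using d by simp
    fix s :: real and x :: "nat \<Rightarrow> real"
    assume s: "\<bar>s - 1\<bar> < min d (1/2)" and x: "\<And>i. i < k \<Longrightarrow> \<bar>x i\<bar> \<le> R"
    define y where "y i = (if i < k then x i else 0)" for i
    have "y \<in> K" using x by (force simp: K_def y_def abs_le_iff)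
    moreover have "s \<in> {1/2..3/2 :: real}" using s unfolding atLeastAtMost_iff by linarith
    moreover have "dist (s, y) (1, y) < d" using s by (simp add: dist_Pair_Pair dist_real_def)
    ultimately have "dist (H (s, y)) (H (1, y)) < e" by (intro d(2)) auto
    moreover have "H (s, y) = g (\<lambda>i\<in>{..<k}. x i / sqrt s)" "H (1, y) = g (restrict x {..<k})"
      unfolding H_def by (auto intro!: arg_cong[where f = g] simp: y_def)
    ultimately show "\<bar>g (\<lambda>i\<in>{..<k}. x i / sqrt s) - g (restrict x {..<k})\<bar> < e"
      by (simp add: dist_real_def)
  qed
qed

section \<open>From weak convergence to convergence of moments\<close>

lemma integral_min_tendsto:
  fixes h :: "'a \<Rightarrow> real"
  assumes "integrable M h" "\<And>x. x \<in> space M \<Longrightarrow> 0 \<le> h x"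
  shows "(\<lambda>n. \<integral>x. min (h x) (real n) \<partial>M) \<longlonglongrightarrow> (\<integral>x. h x \<partial>M)"
proof (rule integral_dominated_convergence[where w = h])
  show "AE x in M. (\<lambda>n. min (h x) (real n)) \<longlonglongrightarrow> h x"
  proof (intro AE_I2 tendsto_eventually)
    fix x
    show "\<forall>\<^sub>F n in sequentially. min (h x) (real n) = h x"
      using eventually_ge_at_top[of "nat \<lceil>h x\<rceil>"] by eventually_elim linarith
  qed
qed (use assms in auto)

text \<open>Markov-type estimate: where \<open>t\<close> exceeds \<open>m\<close>, the factor
  (t/m)^(q-1) is at least 1, so multiplying \<open>t\<close> by it only increases the bound. Below
  \<open>m\<close> the left side vanishes.\<close>

lemma truncation_error_le:
  fixes t m q :: real
  assumes "0 \<le> t" "0 < m" "1 < q"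
  shows "t - min t m \<le> t powr q / m powr (q - 1)"
proof (cases "t \<le> m")
  case False
  hence "t * m powr (q - 1) \<le> t * t powr (q - 1)"
    using assms by (intro mult_left_mono powr_mono2) auto
  also have "\<dots> = t powr q"
    using False assms by (simp add: powr_diff)
  finally have "t \<le> t powr q / m powr (q - 1)"
    using assms by (simp add: pos_le_divide_eq)
  thus ?thesis using False assms by (simp add: min_def)
qed auto

text \<open>A bounded moment of order \<open>q\<close> above 1 makes \<open>h\<close> uniformly
  integrable. The truncation min(h, m) is an admissible test function, and replacing
  \<open>h\<close> by it costs at most C m^(1-q) under \<open>\<mu> n\<close>, uniformly in
  \<open>n\<close>; under \<open>\<nu>\<close> the cost vanishes as \<open>m\<close> grows. Hence
  three errors of size e/3.\<close>

lemma weak_conv_Rn_integral_tendsto: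
  fixes h :: "(nat \<Rightarrow> real) \<Rightarrow> real"
  assumes wc: "weak_conv_Rn k \<mu> \<nu>"
    and cont: "continuous_map (product_topology (\<lambda>_. euclideanreal) {..<k}) euclideanreal h"
    and nonneg: "\<And>x. 0 \<le> h x"
    and mu: "\<forall>\<^sub>F n in sequentially. prob_measure_Rn k (\<mu> n)"
    and q: "1 < q"
    and bound: "\<forall>\<^sub>F n in sequentially.
          integrable (\<mu> n) (\<lambda>x. h x powr q) \<and> (\<integral>x. h x powr q \<partial>\<mu> n) \<le> C"
    and nu: "integrable \<nu> h"
  shows "(\<lambda>n. \<integral>x. h x \<partial>\<mu> n) \<longlonglongrightarrow> (\<integral>x. h x \<partial>\<nu>)"
proof (rule LIMSEQ_I)
  fix e :: real assume e: "0 < e"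
  \<comment> \<open>The level \<open>m\<close> is fixed first, independently of \<open>n\<close>, so
    that both truncation errors are below e/3. Only then does \<open>n\<close> tend to
    infinity.\<close>
  have "(\<lambda>m. C * real m powr (- (q - 1))) \<longlonglongrightarrow> C * 0"
    using q by (intro tendsto_mult tendsto_const tendsto_neg_powr filterlim_real_sequentially) auto
  hence "\<forall>\<^sub>F m in sequentially. C * real m powr (- (q - 1)) < e / 3"
    using e by (intro order_tendstoD) auto
  moreover have "\<forall>\<^sub>F m in sequentially. \<bar>(\<integral>x. min (h x) (real m) \<partial>\<nu>) - (\<integral>x. h x \<partial>\<nu>)\<bar> < e / 3"
    using tendstoD[OF integral_min_tendsto[OF nu nonneg], of "e / 3"] e by (simp add: dist_real_def)
  ultimately have "\<forall>\<^sub>F m in sequentially. C * real m powr (- (q - 1)) < e / 3 \<and>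
      \<bar>(\<integral>x. min (h x) (real m) \<partial>\<nu>) - (\<integral>x. h x \<partial>\<nu>)\<bar> < e / 3 \<and> 1 \<le> m"
    using eventually_ge_at_top[of 1] by eventually_elim simp
  then obtain m :: nat where m: "C * real m powr (- (q - 1)) < e / 3" "1 \<le> m"
      "\<bar>(\<integral>x. min (h x) (real m) \<partial>\<nu>) - (\<integral>x. h x \<partial>\<nu>)\<bar> < e / 3"
    by (auto simp: eventually_sequentially)
  let ?t = "\<lambda>x. min (h x) (real m)"
  have "continuous_map (product_topology (\<lambda>_. euclideanreal) {..<k}) euclideanreal ?t"
    using cont by (intro continuous_map_real_min) auto
  moreover have "bounded (?t ` A)" for A
    by (rule boundedI[of _ "real m"]) (auto simp: nonneg abs_of_nonneg)
  ultimately have "(\<lambda>n. \<integral>x. ?t x \<partial>\<mu> n) \<longlonglongrightarrow> (\<integral>x. ?t x \<partial>\<nu>)"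
    using wc unfolding weak_conv_Rn_def by blast
  from tendstoD[OF this, of "e / 3"] e
  have "\<forall>\<^sub>F n in sequentially. \<bar>(\<integral>x. ?t x \<partial>\<mu> n) - (\<integral>x. ?t x \<partial>\<nu>)\<bar> < e / 3"
    by (simp add: dist_real_def)
  with mu bound have "\<forall>\<^sub>F n in sequentially. norm ((\<integral>x. h x \<partial>\<mu> n) - (\<integral>x. h x \<partial>\<nu>)) < e"
  proof eventually_elim
    case (elim n)
    then interpret prob_space "\<mu> n" by (simp add: prob_measure_Rn_def)
    have meas: "h \<in> borel_measurable (\<mu> n)"
      using borel_measurable_continuous_map_Rn[OF cont] elim
      by (simp add: prob_measure_Rn_def cong: measurable_cong_sets)
    \<comment> \<open>The truncation estimate at level 1; it yields integrability of
      \<open>h\<close> from that of its power \<open>q\<close>.\<close>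
    have le: "h x \<le> 1 + h x powr q" for x
      using truncation_error_le[OF nonneg, of 1 q x] q powr_ge_zero[of "h x" q]
      by (simp add: min_def del: powr_ge_zero split: if_splits)
    have int: "integrable (\<mu> n) h"
      by (rule Bochner_Integration.integrable_bound[of _ "\<lambda>x. 1 + h x powr q"])
         (use elim meas nonneg le in \<open>auto intro: order_trans[OF le]\<close>)
    have intt: "integrable (\<mu> n) ?t"
      using int by simp
    have "(\<integral>x. h x \<partial>\<mu> n) - (\<integral>x. ?t x \<partial>\<mu> n) = (\<integral>x. h x - ?t x \<partial>\<mu> n)"
      using int intt by simp
    also have "\<dots> \<le> (\<integral>x. h x powr q / real m powr (q - 1) \<partial>\<mu> n)"
      using elim int intt m q nonneg by (intro integral_mono truncation_error_le) auto
    also have "\<dots> = (\<integral>x. h x powr q \<partial>\<mu> n) * real m powr (- (q - 1))"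
      by (simp add: powr_minus divide_inverse del: minus_diff_eq)
    also have "\<dots> \<le> C * real m powr (- (q - 1))"
      using elim by (intro mult_right_mono) auto
    finally have "(\<integral>x. h x \<partial>\<mu> n) - (\<integral>x. ?t x \<partial>\<mu> n) < e / 3" using m by simp
    \<comment> \<open>The truncation error is nonnegative, so the upper bound just obtained also
      bounds its absolute value.\<close>
    moreover have "(\<integral>x. ?t x \<partial>\<mu> n) \<le> (\<integral>x. h x \<partial>\<mu> n)"
      using int intt by (intro integral_mono) auto
    ultimately show ?case using elim m(3) by (simp only: real_norm_def)
  qed
  thus "\<exists>n0. \<forall>n\<ge>n0. norm ((\<integral>x. h x \<partial>\<mu> n) - (\<integral>x. h x \<partial>\<nu>)) < e"
    by (simp add: eventually_sequentially)
qed

section \<open>Symmetric measures and the mean square deviation of |x|^2/N from 1\<close>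

lemma symmetric_Rn_distr:
  assumes "prob_measure_Rn N \<mu>" "symmetric_Rn N \<mu>" "\<pi> permutes {..<N}"
    and h: "h \<in> borel_measurable (borel_Rn N)"
  shows "integrable \<mu> (\<lambda>x. h (\<lambda>i\<in>{..<N}. x (\<pi> i))) \<longleftrightarrow> integrable \<mu> (h :: _ \<Rightarrow> real)"
    and "(\<integral>x. h (\<lambda>i\<in>{..<N}. x (\<pi> i)) \<partial>\<mu>) = (\<integral>x. h x \<partial>\<mu>)"
proof -
  have sets: "sets \<mu> = sets (borel_Rn N)" and
    inv: "distr \<mu> (borel_Rn N) (\<lambda>x. \<lambda>i\<in>{..<N}. x (\<pi> i)) = \<mu>"
    using assms by (auto simp: prob_measure_Rn_def symmetric_Rn_def)
  have "(\<lambda>x. \<lambda>i\<in>{..<N}. x (\<pi> i)) \<in> borel_Rn N \<rightarrow>\<^sub>M borel_Rn N"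
    using permutes_in_image[OF assms(3)]
    by (intro measurable_restrict measurable_component_singleton) auto
  hence m: "(\<lambda>x. \<lambda>i\<in>{..<N}. x (\<pi> i)) \<in> \<mu> \<rightarrow>\<^sub>M borel_Rn N"
    by (simp add: sets cong: measurable_cong_sets)
  show "integrable \<mu> (\<lambda>x. h (\<lambda>i\<in>{..<N}. x (\<pi> i))) \<longleftrightarrow> integrable \<mu> h"
    using integrable_distr_eq[OF m h] inv by simp
  show "(\<integral>x. h (\<lambda>i\<in>{..<N}. x (\<pi> i)) \<partial>\<mu>) = (\<integral>x. h x \<partial>\<mu>)"
    using integral_distr[OF m h] inv by simp
qed

lemma symmetric_Rn_coordinate:
  fixes u :: "real \<Rightarrow> real"
  assumes "prob_measure_Rn N \<mu>" "symmetric_Rn N \<mu>" "i < N" "u \<in> borel_measurable borel"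
  shows "integrable \<mu> (\<lambda>x. u (x i)) \<longleftrightarrow> integrable \<mu> (\<lambda>x. u (x 0))"
    and "(\<integral>x. u (x i) \<partial>\<mu>) = (\<integral>x. u (x 0) \<partial>\<mu>)"
proof -
  have "Transposition.transpose 0 i permutes {..<N}"
    using assms(3) by (intro permutes_swap_id) auto
  moreover have "(\<lambda>x. u (x 0)) \<in> borel_measurable (borel_Rn N)"
    using assms by (auto intro: measurable_compose[OF measurable_component_singleton])
  ultimately show "integrable \<mu> (\<lambda>x. u (x i)) \<longleftrightarrow> integrable \<mu> (\<lambda>x. u (x 0))"
    "(\<integral>x. u (x i) \<partial>\<mu>) = (\<integral>x. u (x 0) \<partial>\<mu>)"
    using symmetric_Rn_distr[OF assms(1,2), of "Transposition.transpose 0 i" "\<lambda>x. u (x 0)"] assms(3)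
    by (simp_all add: Transposition.transpose_def)
qed

lemma symmetric_Rn_coordinate_pair:
  fixes u v :: "real \<Rightarrow> real"
  assumes "prob_measure_Rn N \<mu>" "symmetric_Rn N \<mu>" "i < N" "j < N" "i \<noteq> j"
    and "u \<in> borel_measurable borel" "v \<in> borel_measurable borel"
  shows "(\<integral>x. u (x i) * v (x j) \<partial>\<mu>) = (\<integral>x. u (x 0) * v (x 1) \<partial>\<mu>)"
proof -
  \<comment> \<open>A permutation sending 0 to \<open>i\<close> and 1 to \<open>j\<close>. The first
    swap may already move 1 (when \<open>i\<close> is 1), so the second one exchanges
    \<open>j\<close> with the current image of 1; it leaves \<open>i\<close> alone, since
    \<open>i\<close> differs from \<open>j\<close> and from that image.\<close>
  define \<pi> where "\<pi> = Transposition.transpose (Transposition.transpose 0 i 1) j \<circ> Transposition.transpose 0 i"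
  have N: "0 < N" "1 < N" using assms by auto
  have "\<pi> permutes {..<N}"
    unfolding \<pi>_def using assms N
    by (intro permutes_compose permutes_swap_id) (auto simp: Transposition.transpose_def)
  moreover have "\<pi> 0 = i" "\<pi> 1 = j"
    using assms(5) by (auto simp: \<pi>_def Transposition.transpose_def)
  moreover have "(\<lambda>x. u (x 0) * v (x 1)) \<in> borel_measurable (borel_Rn N)"
    using N assms
    by (intro borel_measurable_times) (auto intro: measurable_compose[OF measurable_component_singleton])
  ultimately show ?thesis
    using symmetric_Rn_distr(2)[OF assms(1,2), of \<pi> "\<lambda>x. u (x 0) * v (x 1)"] N by simp
qed

text \<open>Expanding the square produces the double sum of x_i^2 x_j^2. By symmetry its
  \<open>N\<close> diagonal terms all have the mean of x_0^4 and its N(N-1) other terms the mean of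
  x_0^2 x_1^2. For \<open>N\<close> equal to 1 the coordinate \<open>x 1\<close> is only a default
  value, but its coefficient 1 - 1/N is then 0.\<close>

lemma mean_square_deviation:
  assumes prob: "prob_measure_Rn N \<mu>" and sym: "symmetric_Rn N \<mu>" and N: "1 \<le> N"
    and int4: "integrable \<mu> (\<lambda>x. (x 0) ^ 4)"
  shows "integrable \<mu> (\<lambda>x. ((\<Sum>i<N. (x i)\<^sup>2) / N - 1)\<^sup>2)"
    and "(\<integral>x. ((\<Sum>i<N. (x i)\<^sup>2) / N - 1)\<^sup>2 \<partial>\<mu>) =
      (\<integral>x. (x 0) ^ 4 \<partial>\<mu>) / N + (1 - 1 / N) * (\<integral>x. (x 0)\<^sup>2 * (x 1)\<^sup>2 \<partial>\<mu>)
      - 2 * (\<integral>x. (x 0)\<^sup>2 \<partial>\<mu>) + 1"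
proof -
  interpret prob_space \<mu> using prob by (simp add: prob_measure_Rn_def)
  define A where "A = (\<integral>x. (x 0) ^ 4 \<partial>\<mu>)"
  define B where "B = (\<integral>x. (x 0)\<^sup>2 * (x 1)\<^sup>2 \<partial>\<mu>)"
  define D where "D = (\<integral>x. (x 0)\<^sup>2 \<partial>\<mu>)"
  have [measurable]: "(\<lambda>x. x i) \<in> borel_measurable \<mu>" if "i < N" for i
    using that prob measurable_component_singleton[of i "{..<N}" "\<lambda>_. borel :: real measure"]
    by (simp add: prob_measure_Rn_def cong: measurable_cong_sets)
  have i4: "integrable \<mu> (\<lambda>x. (x i) ^ 4)" and e4: "(\<integral>x. (x i) ^ 4 \<partial>\<mu>) = A" if "i < N" for i
    using symmetric_Rn_coordinate[OF prob sym that, of "\<lambda>t. t ^ 4"] int4 by (auto simp: A_def)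
  have i22: "integrable \<mu> (\<lambda>x. (x i)\<^sup>2 * (x j)\<^sup>2)" if "i < N" "j < N" for i j
  proof (rule Bochner_Integration.integrable_bound)
    \<comment> \<open>Fourth moments alone control the mixed terms, since ab \<le> a^2 + b^2 for
      nonnegative a = x_i^2 and b = x_j^2.\<close>
    show "integrable \<mu> (\<lambda>x. (x i) ^ 4 + (x j) ^ 4)" using i4 that by simp
    show "AE x in \<mu>. norm ((x i)\<^sup>2 * (x j)\<^sup>2) \<le> norm ((x i) ^ 4 + (x j) ^ 4)"
    proof (rule AE_I2)
      fix x :: "nat \<Rightarrow> real"
      have "(x i)\<^sup>2 * (x j)\<^sup>2 \<le> ((x i)\<^sup>2)\<^sup>2 + ((x j)\<^sup>2)\<^sup>2"
        using sum_squares_bound[of "(x i)\<^sup>2" "(x j)\<^sup>2"]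
          mult_nonneg_nonneg[OF zero_le_power2[of "x i"] zero_le_power2[of "x j"]] by linarith
      thus "norm ((x i)\<^sup>2 * (x j)\<^sup>2) \<le> norm ((x i) ^ 4 + (x j) ^ 4)" by simp
    qed
  qed (use that in measurable)
  have e22: "(\<integral>x. (x i)\<^sup>2 * (x j)\<^sup>2 \<partial>\<mu>) = (if i = j then A else B)" if "i < N" "j < N" for i j
    using e4[of i] symmetric_Rn_coordinate_pair[OF prob sym that, of "\<lambda>t. t\<^sup>2" "\<lambda>t. t\<^sup>2"] that
    by (auto simp: B_def simp flip: power_add)
  have "integrable \<mu> (\<lambda>x. (x 0)\<^sup>2)"
    by (rule square_integrable_imp_integrable) (use N int4 in auto)
  hence i2: "integrable \<mu> (\<lambda>x. (x i)\<^sup>2)" and e2: "(\<integral>x. (x i)\<^sup>2 \<partial>\<mu>) = D" if "i < N" for i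
    using symmetric_Rn_coordinate[OF prob sym that, of "\<lambda>t. t\<^sup>2"] by (auto simp: D_def)
  have expand: "((\<Sum>i<N. (x i)\<^sup>2) / N - 1)\<^sup>2 =
      (\<Sum>i<N. \<Sum>j<N. (x i)\<^sup>2 * (x j)\<^sup>2) / N\<^sup>2 - 2 / N * (\<Sum>i<N. (x i)\<^sup>2) + 1" for x :: "nat \<Rightarrow> real"
    unfolding sum_product[symmetric]
    by (simp only: power2_diff power_divide) (simp add: power2_eq_square)
  have dbl: "integrable \<mu> (\<lambda>x. \<Sum>i<N. \<Sum>j<N. (x i)\<^sup>2 * (x j)\<^sup>2)"
    by (intro Bochner_Integration.integrable_sum i22) auto
  have sgl: "integrable \<mu> (\<lambda>x. \<Sum>i<N. (x i)\<^sup>2)"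
    by (intro Bochner_Integration.integrable_sum i2) auto
  show "integrable \<mu> (\<lambda>x. ((\<Sum>i<N. (x i)\<^sup>2) / N - 1)\<^sup>2)"
    unfolding expand
    by (intro Bochner_Integration.integrable_add Bochner_Integration.integrable_diff
        integrable_divide_zero integrable_mult_right dbl sgl) auto
  have "(\<integral>x. (\<Sum>i<N. \<Sum>j<N. (x i)\<^sup>2 * (x j)\<^sup>2) \<partial>\<mu>) = (\<Sum>i<N. \<Sum>j<N. if i = j then A else B)"
  proof -
    have "(\<integral>x. (\<Sum>i<N. \<Sum>j<N. (x i)\<^sup>2 * (x j)\<^sup>2) \<partial>\<mu>) =
        (\<Sum>i<N. \<integral>x. (\<Sum>j<N. (x i)\<^sup>2 * (x j)\<^sup>2) \<partial>\<mu>)"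
      by (intro Bochner_Integration.integral_sum Bochner_Integration.integrable_sum i22) auto
    also have "\<dots> = (\<Sum>i<N. \<Sum>j<N. \<integral>x. (x i)\<^sup>2 * (x j)\<^sup>2 \<partial>\<mu>)"
      by (intro sum.cong refl Bochner_Integration.integral_sum i22) auto
    also have "\<dots> = (\<Sum>i<N. \<Sum>j<N. if i = j then A else B)"
      by (intro sum.cong refl e22) auto
    finally show ?thesis .
  qed
  moreover have "(\<integral>x. (\<Sum>i<N. (x i)\<^sup>2) \<partial>\<mu>) = (\<Sum>i<N. D)"
    by (simp add: i2 e2)
  ultimately have "(\<integral>x. ((\<Sum>i<N. (x i)\<^sup>2) / N - 1)\<^sup>2 \<partial>\<mu>) =
      (\<Sum>i<N. \<Sum>j<N. if i = j then A else B) / N\<^sup>2 - 2 / N * (\<Sum>i<N. D) + 1"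
    unfolding expand using dbl sgl by (simp add: prob_space)
  \<comment> \<open>Each row of the double sum has one diagonal entry and N - 1 others.\<close>
  also have "(\<Sum>j<N. if i = j then A else B) = A + (real N - 1) * B" if "i < N" for i
  proof -
    have "(\<Sum>j<N. if i = j then A else B) = A + (\<Sum>j\<in>{..<N} - {i}. if i = j then A else B)"
      using that by (subst sum.remove[of _ i]) auto
    also have "(\<Sum>j\<in>{..<N} - {i}. if i = j then A else B) = (\<Sum>j\<in>{..<N} - {i}. B)"
      by (intro sum.cong) auto
    finally show ?thesis using that by (simp add: of_nat_diff)
  qed
  hence "(\<Sum>i<N. \<Sum>j<N. if i = j then A else B) = real N * (A + (real N - 1) * B)" by simp
  finally show "(\<integral>x. ((\<Sum>i<N. (x i)\<^sup>2) / N - 1)\<^sup>2 \<partial>\<mu>) = A / N + (1 - 1 / N) * B - 2 * D + 1"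
    using N by (simp add: field_simps power2_eq_square)
qed

section \<open>Marginals and the limits of the means of x_0^2 and x_0^2 x_1^2\<close>

lemma prob_measure_Rn_marginal:
  assumes "prob_measure_Rn N \<mu>" "k \<le> N"
  shows "prob_measure_Rn k (marginal_Rn k \<mu>)"
    and "(\<lambda>x. restrict x {..<k}) \<in> \<mu> \<rightarrow>\<^sub>M borel_Rn k"
proof -
  show m: "(\<lambda>x. restrict x {..<k}) \<in> \<mu> \<rightarrow>\<^sub>M borel_Rn k"
    using measurable_restrict_subset[of "{..<k}" "{..<N}" "\<lambda>_. borel :: real measure"] assms
    by (simp add: prob_measure_Rn_def cong: measurable_cong_sets)
  show "prob_measure_Rn k (marginal_Rn k \<mu>)"
    using assms prob_space.prob_space_distr[OF _ m] by (simp add: prob_measure_Rn_def marginal_Rn_def)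
qed

text \<open>Supplies the moment of order p/4 needed for uniform integrability. In terms of b_i =
  |x_i|^(p/2) the left side is b_0 or b_0 b_1 and |x_i|^p is b_i^2, so that elementary inequalities
  between products and squares suffice.\<close>

lemma prod_square_powr_le:
  fixes x :: "nat \<Rightarrow> real"
  assumes "k = 1 \<or> k = 2" "0 < p"
  shows "(\<Prod>i<k. (x i)\<^sup>2) powr (p / 4) \<le> 1 + (\<Sum>i<k. \<bar>x i\<bar> powr p)"
proof -
  define b where "b i = \<bar>x i\<bar> powr (p / 2)" for i
  have sq: "((x i)\<^sup>2) powr (p / 4) = b i" for i
  proof -
    have "(x i)\<^sup>2 = \<bar>x i\<bar> powr 2" by simp
    thus ?thesis by (simp only: powr_powr b_def) simp
  qed
  have pw: "\<bar>x i\<bar> powr p = (b i)\<^sup>2" for i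
    by (simp add: b_def power2_eq_square flip: powr_add)
  have 1: "b 0 \<le> 1 + (b 0)\<^sup>2"
    using sum_squares_bound[of 1 "b 0"] powr_ge_zero[of "\<bar>x 0\<bar>" "p / 2"]
    by (simp add: b_def del: powr_ge_zero)
  have 2: "b 0 * b 1 \<le> (b 0)\<^sup>2 + (b 1)\<^sup>2"
  proof -
    have "0 \<le> b 0 * b 1" by (simp add: b_def)
    thus ?thesis using sum_squares_bound[of "b 0" "b 1"] by linarith
  qed
  show ?thesis
    using assms(1)
  proof
    assume "k = 1"
    thus ?thesis using 1 by (simp add: sq pw)
  next
    assume "k = 2"
    hence "{..<k} = {0, 1}" by auto
    thus ?thesis using 2 by (simp add: sq pw powr_mult)
  qed
qed

text \<open>Chaos of order \<open>k\<close> gives weak convergence of the \<open>k\<close>-th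
  marginal to the product measure, under which the product of squares has mean 1^k by independence.
  The moment bound extends the convergence to this unbounded function.\<close>

lemma product_moment_tendsto:
  assumes f: "real_distribution f" "(\<integral>x. x\<^sup>2 \<partial>f) = 1"
    and chaos: "Kac_chaotic F f" and p: "4 < p" and k: "k = 1 \<or> k = 2"
    and bound: "\<And>N. 1 \<le> N \<Longrightarrow>
      integrable (F N) (\<lambda>x. \<bar>x 0\<bar> powr p) \<and> (\<integral>x. \<bar>x 0\<bar> powr p \<partial>F N) \<le> C"
  shows "(\<lambda>N. \<integral>x. (\<Prod>i<k. (x i)\<^sup>2) \<partial>F N) \<longlonglongrightarrow> 1"
proof -
  define h where "h x = (\<Prod>i<k. (x i)\<^sup>2)" for x :: "nat \<Rightarrow> real"
  have F: "prob_measure_Rn N (F N)" "symmetric_Rn N (F N)" if "1 \<le> N" for N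
    using chaos that by (auto simp: Kac_chaotic_def)
  interpret f: real_distribution f by fact
  interpret product_sigma_finite "\<lambda>_. f" by unfold_locales
  have cont: "continuous_map (product_topology (\<lambda>_. euclideanreal) {..<k}) euclideanreal h"
    unfolding h_def
    by (intro continuous_map_prod continuous_map_real_pow continuous_map_product_projection) auto
  \<comment> \<open>A non-integrable function has Bochner integral 0 by convention, so the value 1
    forces integrability.\<close>
  have "integrable f (\<lambda>x. x\<^sup>2)"
    using f(2) not_integrable_integral_eq by fastforce
  hence nu: "integrable (PiM {..<k} (\<lambda>_. f)) h" "(\<integral>x. h x \<partial>PiM {..<k} (\<lambda>_. f)) = 1"
    unfolding h_def using f(2) product_integrable_prod[of "{..<k}" "\<lambda>_ x. x\<^sup>2"]
      product_integral_prod[of "{..<k}" "\<lambda>_ x. x\<^sup>2"] by auto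
  have h_nonneg: "0 \<le> h x" for x by (simp add: h_def prod_nonneg)
  \<comment> \<open>Since \<open>h\<close> reads only the first \<open>k\<close> coordinates, its
    integrals may be computed under \<open>F N\<close>. The function \<open>u\<close> will be the
    power p/4 and then the identity.\<close>
  have marg: "integrable (marginal_Rn k (F N)) (\<lambda>x. u (h x)) \<longleftrightarrow> integrable (F N) (\<lambda>x. u (h x))"
    "(\<integral>x. u (h x) \<partial>marginal_Rn k (F N)) = (\<integral>x. u (h x) \<partial>F N)"
    if "k \<le> N" "u \<in> borel_measurable borel" for N and u :: "real \<Rightarrow> real"
  proof -
    have "1 \<le> N" using k that by auto
    hence m: "(\<lambda>x. restrict x {..<k}) \<in> F N \<rightarrow>\<^sub>M borel_Rn k"
      using F that by (intro prob_measure_Rn_marginal)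
    have h: "(\<lambda>x. u (h x)) \<in> borel_measurable (borel_Rn k)"
      using borel_measurable_continuous_map_Rn[OF cont] that by measurable
    have "h (restrict x {..<k}) = h x" for x by (simp add: h_def)
    thus "integrable (marginal_Rn k (F N)) (\<lambda>x. u (h x)) \<longleftrightarrow> integrable (F N) (\<lambda>x. u (h x))"
      "(\<integral>x. u (h x) \<partial>marginal_Rn k (F N)) = (\<integral>x. u (h x) \<partial>F N)"
      using integrable_distr_eq[OF m h] integral_distr[OF m h] by (simp_all add: marginal_Rn_def)
  qed
  have "(\<lambda>N. \<integral>x. h x \<partial>marginal_Rn k (F N)) \<longlonglongrightarrow> (\<integral>x. h x \<partial>PiM {..<k} (\<lambda>_. f))"
  proof (rule weak_conv_Rn_integral_tendsto)
    show "weak_conv_Rn k (\<lambda>N. marginal_Rn k (F N)) (PiM {..<k} (\<lambda>_. f))"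
      using chaos k by (auto simp: Kac_chaotic_def)
    show "\<forall>\<^sub>F N in sequentially. prob_measure_Rn k (marginal_Rn k (F N))"
      using eventually_ge_at_top[of k]
    proof eventually_elim
      case (elim N)
      hence "1 \<le> N" using k by auto
      from prob_measure_Rn_marginal(1)[OF F(1)[OF this] elim] show ?case .
    qed
    \<comment> \<open>This is where p > 4 enters: the exponent must be strictly above 1. The
      constant \<open>1 + real k * C\<close> of the moment bound comes from integrating
      \<open>prod_square_powr_le\<close>, each of the \<open>k\<close> moments being at most
      \<open>C\<close> by symmetry.\<close>
    show "1 < p / 4" using p by simp
    show "\<forall>\<^sub>F N in sequentially. integrable (marginal_Rn k (F N)) (\<lambda>x. h x powr (p / 4)) \<and>
        (\<integral>x. h x powr (p / 4) \<partial>marginal_Rn k (F N)) \<le> 1 + real k * C"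
      using eventually_ge_at_top[of k]
    proof eventually_elim
      case (elim N)
      hence N: "1 \<le> N" using k by auto
      interpret prob_space "F N" using F[OF N] by (simp add: prob_measure_Rn_def)
      have I: "integrable (F N) (\<lambda>x. \<bar>x i\<bar> powr p)" "(\<integral>x. \<bar>x i\<bar> powr p \<partial>F N) \<le> C" if "i < k" for i
        using symmetric_Rn_coordinate[OF F[OF N], of i "\<lambda>t. \<bar>t\<bar> powr p"] bound[OF N] that elim by auto
      have le: "h x powr (p / 4) \<le> 1 + (\<Sum>i<k. \<bar>x i\<bar> powr p)" for x
        unfolding h_def using k p by (intro prod_square_powr_le) auto
      have "(\<lambda>x. x i) \<in> borel_measurable (F N)" if "i < k" for i
        using that elim F[OF N] measurable_component_singleton[of i "{..<N}" "\<lambda>_. borel :: real measure"]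
        by (simp add: prob_measure_Rn_def cong: measurable_cong_sets)
      hence meas: "(\<lambda>x. h x powr (p / 4)) \<in> borel_measurable (F N)"
        unfolding h_def by measurable
      have int: "integrable (F N) (\<lambda>x. 1 + (\<Sum>i<k. \<bar>x i\<bar> powr p))"
        by (intro Bochner_Integration.integrable_add Bochner_Integration.integrable_sum I) auto
      have int': "integrable (F N) (\<lambda>x. h x powr (p / 4))"
        by (rule Bochner_Integration.integrable_bound[OF int meas]) (auto intro!: AE_I2 order_trans[OF le abs_ge_self])
      have "(\<integral>x. h x powr (p / 4) \<partial>F N) \<le> (\<integral>x. 1 + (\<Sum>i<k. \<bar>x i\<bar> powr p) \<partial>F N)"
        by (rule integral_mono[OF int' int le])
      also have "\<dots> = 1 + (\<Sum>i<k. \<integral>x. \<bar>x i\<bar> powr p \<partial>F N)"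
      proof -
        have "integrable (F N) (\<lambda>x. \<Sum>i<k. \<bar>x i\<bar> powr p)"
          by (intro Bochner_Integration.integrable_sum I) auto
        moreover have "(\<integral>x. (\<Sum>i<k. \<bar>x i\<bar> powr p) \<partial>F N) = (\<Sum>i<k. \<integral>x. \<bar>x i\<bar> powr p \<partial>F N)"
          by (intro Bochner_Integration.integral_sum I) auto
        ultimately show ?thesis by (simp add: prob_space)
      qed
      also have "\<dots> \<le> 1 + (\<Sum>i<k. C)"
        by (intro add_left_mono sum_mono I) auto
      finally show ?case
        using int' marg[of N "\<lambda>t. t powr (p / 4)"] elim by simp
    qed
  qed (use cont nu(1) h_nonneg in auto)
  moreover have "\<forall>\<^sub>F N in sequentially. (\<integral>x. h x \<partial>marginal_Rn k (F N)) = (\<integral>x. h x \<partial>F N)"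
    using eventually_ge_at_top[of k] by eventually_elim (use marg(2)[of _ "\<lambda>t. t"] in simp)
  ultimately have "(\<lambda>N. \<integral>x. h x \<partial>F N) \<longlonglongrightarrow> (\<integral>x. h x \<partial>PiM {..<k} (\<lambda>_. f))"
    by (rule Lim_transform_eventually)
  thus ?thesis unfolding nu(2) by (simp only: h_def)
qed

section \<open>The rescaled measures: symmetry and comparison of marginals\<close>

text \<open>The Euclidean norm is invariant under permutations of the coordinates, so rescaling
  commutes with them, and the symmetry of \<open>\<mu>\<close> passes to its push-forward.\<close>

lemma symmetric_Rn_rescaled:
  assumes "prob_measure_Rn N \<mu>" "symmetric_Rn N \<mu>"
  shows "prob_measure_Rn N (rescaled_measure N \<mu>)" "symmetric_Rn N (rescaled_measure N \<mu>)"
proof -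
  have sets: "sets \<mu> = sets (borel_Rn N)" using assms by (simp add: prob_measure_Rn_def)
  have m: "sphere_rescale N \<in> \<mu> \<rightarrow>\<^sub>M borel_Rn N"
    using sphere_rescale_measurable by (simp add: sets cong: measurable_cong_sets)
  show "prob_measure_Rn N (rescaled_measure N \<mu>)"
    using assms prob_space.prob_space_distr[OF _ m]
    by (simp add: prob_measure_Rn_def rescaled_measure_def)
  show "symmetric_Rn N (rescaled_measure N \<mu>)"
    unfolding symmetric_Rn_def
  proof (intro allI impI)
    fix \<pi> assume \<pi>: "\<pi> permutes {..<N}"
    let ?P = "\<lambda>x :: nat \<Rightarrow> real. \<lambda>i\<in>{..<N}. x (\<pi> i)"
    have lt: "\<pi> i < N \<longleftrightarrow> i < N" for i using permutes_in_image[OF \<pi>, of i] by simp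
    have P: "?P \<in> borel_Rn N \<rightarrow>\<^sub>M borel_Rn N"
      by (intro measurable_restrict measurable_component_singleton) (simp add: lt)
    hence P': "?P \<in> \<mu> \<rightarrow>\<^sub>M borel_Rn N" by (simp add: sets cong: measurable_cong_sets)
    have "(\<Sum>i<N. (x (\<pi> i))\<^sup>2) = (\<Sum>i<N. (x i)\<^sup>2)" for x :: "nat \<Rightarrow> real"
      using sum.permute[OF \<pi>, of "\<lambda>i. (x i)\<^sup>2"] by (simp add: o_def)
    hence comm: "?P \<circ> sphere_rescale N = sphere_rescale N \<circ> ?P"
      by (auto simp: fun_eq_iff sphere_rescale_def L2_set_def lt)
    have "distr (rescaled_measure N \<mu>) (borel_Rn N) ?P = distr \<mu> (borel_Rn N) (?P \<circ> sphere_rescale N)"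
      unfolding rescaled_measure_def by (rule distr_distr[OF P m])
    also have "\<dots> = distr (distr \<mu> (borel_Rn N) ?P) (borel_Rn N) (sphere_rescale N)"
      unfolding comm by (rule distr_distr[OF sphere_rescale_measurable P', symmetric])
    also have "distr \<mu> (borel_Rn N) ?P = \<mu>" using assms(2) \<pi> by (simp add: symmetric_Rn_def)
    finally show "distr (rescaled_measure N \<mu>) (borel_Rn N) ?P = rescaled_measure N \<mu>"
      by (simp only: rescaled_measure_def)
  qed
qed

text \<open>Writes the factor sqrt N / |x| as 1 / sqrt s with s = |x|^2/N, the form used in
  \<open>uniform_continuity_dilation\<close>.\<close>

lemma restrict_sphere_rescale:
  assumes "k \<le> N"
  shows "restrict (sphere_rescale N x) {..<k} = (\<lambda>i\<in>{..<k}. x i / sqrt ((\<Sum>i<N. (x i)\<^sup>2) / N))"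
  using assms by (auto simp: sphere_rescale_def L2_set_def fun_eq_iff real_sqrt_divide)

text \<open>Both integrals are taken over \<open>\<mu>\<close>. On the event that |x|^2/N is within
  \<open>d\<close> of 1 and the first \<open>k\<close> coordinates lie in [-R, R], the integrands
  differ by less than \<open>e\<close>; elsewhere they differ by at most 2M, and Chebyshev bounds
  the probability of the complement.\<close>

lemma rescaled_integral_diff_le:
  fixes g :: "(nat \<Rightarrow> real) \<Rightarrow> real"
  assumes prob: "prob_measure_Rn N \<mu>" and sym: "symmetric_Rn N \<mu>" and k: "k \<le> N" and N: "1 \<le> N"
    and int4: "integrable \<mu> (\<lambda>x. (x 0) ^ 4)"
    and cont: "continuous_map (product_topology (\<lambda>_. euclideanreal) {..<k}) euclideanreal g"
    and M: "\<And>x. x \<in> PiE {..<k} (\<lambda>_. UNIV) \<Longrightarrow> \<bar>g x\<bar> \<le> M"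
    and d: "0 < d" "\<And>s x. \<bar>s - 1\<bar> < d \<Longrightarrow> (\<And>i. i < k \<Longrightarrow> \<bar>x i\<bar> \<le> R) \<Longrightarrow>
           \<bar>g (\<lambda>i\<in>{..<k}. x i / sqrt s) - g (restrict x {..<k})\<bar> < e"
    and R: "0 < R" and e: "0 \<le> e"
  shows "\<bar>(\<integral>x. g x \<partial>marginal_Rn k (rescaled_measure N \<mu>)) - (\<integral>x. g x \<partial>marginal_Rn k \<mu>)\<bar> \<le>
    e + 2 * M * ((\<integral>x. ((\<Sum>i<N. (x i)\<^sup>2) / N - 1)\<^sup>2 \<partial>\<mu>) / d\<^sup>2 + k * (\<integral>x. (x 0)\<^sup>2 \<partial>\<mu>) / R\<^sup>2)"
proof -
  interpret prob_space \<mu> using prob by (simp add: prob_measure_Rn_def)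
  have sets: "sets \<mu> = sets (borel_Rn N)" using prob by (simp add: prob_measure_Rn_def)
  have meas: "g \<in> borel_measurable (borel_Rn k)"
    by (rule borel_measurable_continuous_map_Rn[OF cont])
  have r: "(\<lambda>x. restrict x {..<k}) \<in> \<mu> \<rightarrow>\<^sub>M borel_Rn k"
    "(\<lambda>x. restrict x {..<k}) \<in> rescaled_measure N \<mu> \<rightarrow>\<^sub>M borel_Rn k"
    using prob_measure_Rn_marginal(2)[OF _ k] prob symmetric_Rn_rescaled(1)[OF prob sym] by auto
  have s: "sphere_rescale N \<in> \<mu> \<rightarrow>\<^sub>M borel_Rn N"
    using sphere_rescale_measurable by (simp add: sets cong: measurable_cong_sets)
  have r': "(\<lambda>x. restrict x {..<k}) \<in> borel_Rn N \<rightarrow>\<^sub>M borel_Rn k"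
    using r(1) by (simp add: sets cong: measurable_cong_sets)
  have m1: "(\<lambda>x. g (restrict x {..<k})) \<in> borel_measurable (borel_Rn N)"
    by (rule measurable_compose[OF r' meas])
  define S where "S x = (\<Sum>i<N. (x i)\<^sup>2) / N" for x :: "nat \<Rightarrow> real"
  define u where "u x = g (restrict (sphere_rescale N x) {..<k})" for x
  define v where "v x = g (restrict x {..<k})" for x
  \<comment> \<open>An integrable majorant of |u - v|: off the good event one of the two quotients
    is at least 1, which puts the Chebyshev bound in pointwise form.\<close>
  define w where "w x = e + 2 * M * ((S x - 1)\<^sup>2 / d\<^sup>2 + (\<Sum>i<k. (x i)\<^sup>2) / R\<^sup>2)" for x
  have eq: "(\<integral>x. g x \<partial>marginal_Rn k (rescaled_measure N \<mu>)) = (\<integral>x. u x \<partial>\<mu>)"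
    "(\<integral>x. g x \<partial>marginal_Rn k \<mu>) = (\<integral>x. v x \<partial>\<mu>)"
    using integral_distr[OF r(1) meas] integral_distr[OF r(2) meas] integral_distr[OF s m1]
    by (simp_all add: u_def v_def marginal_Rn_def rescaled_measure_def)
  have Mr: "\<bar>g (restrict x {..<k})\<bar> \<le> M" for x by (rule M) auto
  have "u \<in> borel_measurable \<mu>" "v \<in> borel_measurable \<mu>"
    unfolding u_def v_def using measurable_compose[OF s m1] measurable_compose[OF r(1) meas] by auto
  hence uv: "integrable \<mu> u" "integrable \<mu> v"
    using Mr by (auto intro!: integrable_const_bound[where B = M] simp: u_def v_def)
  \<comment> \<open>Any point serves here, because \<open>M\<close> bounds an absolute
    value.\<close>
  have M0: "0 \<le> M" using Mr[of undefined] by linarith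
  have le: "\<bar>u x - v x\<bar> \<le> w x" for x
  proof (cases "\<bar>S x - 1\<bar> < d \<and> (\<forall>i<k. \<bar>x i\<bar> \<le> R)")
    case True
    hence "\<bar>u x - v x\<bar> < e"
      unfolding u_def v_def restrict_sphere_rescale[OF k] S_def[symmetric] by (intro d(2)) auto
    moreover have "0 \<le> 2 * M * ((S x - 1)\<^sup>2 / d\<^sup>2 + (\<Sum>i<k. (x i)\<^sup>2) / R\<^sup>2)"
      using M0 by (intro mult_nonneg_nonneg add_nonneg_nonneg divide_nonneg_nonneg sum_nonneg) auto
    ultimately show ?thesis unfolding w_def by linarith
  next
    case False
    have "1 \<le> (S x - 1)\<^sup>2 / d\<^sup>2 + (\<Sum>i<k. (x i)\<^sup>2) / R\<^sup>2"
    proof (cases "d \<le> \<bar>S x - 1\<bar>")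
      case True
      hence "d\<^sup>2 \<le> (S x - 1)\<^sup>2" using d(1) by (metis abs_le_square_iff abs_of_pos)
      hence "1 \<le> (S x - 1)\<^sup>2 / d\<^sup>2" using d(1) by simp
      moreover have "0 \<le> (\<Sum>i<k. (x i)\<^sup>2) / R\<^sup>2"
        by (intro divide_nonneg_nonneg sum_nonneg) auto
      ultimately show ?thesis by linarith
    next
      \<comment> \<open>The deviation is below \<open>d\<close>, so failure of the good event must
        come from a coordinate larger than \<open>R\<close>; its square is one of the
        summands.\<close>
      case Fd: False
      with False obtain i where i: "i < k" "R \<le> \<bar>x i\<bar>" by force
      hence "R\<^sup>2 \<le> (x i)\<^sup>2" using R by (metis abs_le_square_iff abs_of_pos)
      also have "(x i)\<^sup>2 \<le> (\<Sum>i<k. (x i)\<^sup>2)" using i by (intro member_le_sum) auto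
      finally have "1 \<le> (\<Sum>i<k. (x i)\<^sup>2) / R\<^sup>2" using R by simp
      moreover have "0 \<le> (S x - 1)\<^sup>2 / d\<^sup>2" by simp
      ultimately show ?thesis by linarith
    qed
    hence "2 * M * 1 \<le> 2 * M * ((S x - 1)\<^sup>2 / d\<^sup>2 + (\<Sum>i<k. (x i)\<^sup>2) / R\<^sup>2)"
      using M0 by (intro mult_left_mono) auto
    moreover have "\<bar>u x\<bar> \<le> M" "\<bar>v x\<bar> \<le> M" unfolding u_def v_def by (rule Mr)+
    ultimately show ?thesis unfolding w_def using e by linarith
  qed
  have "(\<lambda>x. x 0) \<in> borel_measurable \<mu>"
    using N measurable_component_singleton[of 0 "{..<N}" "\<lambda>_. borel :: real measure"]
    by (simp add: sets cong: measurable_cong_sets)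
  hence "integrable \<mu> (\<lambda>x. (x 0)\<^sup>2)"
    by - (rule square_integrable_imp_integrable, use int4 in auto)
  hence i2: "integrable \<mu> (\<lambda>x. (x i)\<^sup>2)" "(\<integral>x. (x i)\<^sup>2 \<partial>\<mu>) = (\<integral>x. (x 0)\<^sup>2 \<partial>\<mu>)" if "i < k" for i
    using symmetric_Rn_coordinate[OF prob sym, of i "\<lambda>t. t\<^sup>2"] that k by auto
  have iS: "integrable \<mu> (\<lambda>x. (S x - 1)\<^sup>2)"
    unfolding S_def by (rule mean_square_deviation(1)[OF prob sym N int4])
  have isum: "integrable \<mu> (\<lambda>x. \<Sum>i<k. (x i)\<^sup>2)"
    by (intro Bochner_Integration.integrable_sum i2) auto
  have iw: "integrable \<mu> w"
    unfolding w_def using iS isum by (intro Bochner_Integration.integrable_add integrable_mult_right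
        integrable_divide_zero) auto
  have "(\<integral>x. (\<Sum>i<k. (x i)\<^sup>2) \<partial>\<mu>) = (\<Sum>i<k. \<integral>x. (x i)\<^sup>2 \<partial>\<mu>)"
    by (intro Bochner_Integration.integral_sum i2) auto
  also have "\<dots> = (\<Sum>i<k. \<integral>x. (x 0)\<^sup>2 \<partial>\<mu>)"
    by (intro sum.cong refl i2(2)) auto
  also have "\<dots> = k * (\<integral>x. (x 0)\<^sup>2 \<partial>\<mu>)" by simp
  finally have ew: "(\<integral>x. w x \<partial>\<mu>) = e + 2 * M * ((\<integral>x. (S x - 1)\<^sup>2 \<partial>\<mu>) / d\<^sup>2 + k * (\<integral>x. (x 0)\<^sup>2 \<partial>\<mu>) / R\<^sup>2)"
    unfolding w_def using iS isum by (simp add: prob_space del: Bochner_Integration.integral_sum)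
  have "\<bar>(\<integral>x. u x \<partial>\<mu>) - (\<integral>x. v x \<partial>\<mu>)\<bar> = \<bar>\<integral>x. u x - v x \<partial>\<mu>\<bar>"
    using uv by simp
  also have "\<dots> \<le> (\<integral>x. \<bar>u x - v x\<bar> \<partial>\<mu>)" by (rule integral_abs_bound)
  also have "\<dots> \<le> (\<integral>x. w x \<partial>\<mu>)" using uv iw le by (intro integral_mono) auto
  finally show ?thesis unfolding eq ew unfolding S_def .
qed

section \<open>Vanishing mean square deviation and chaos of the rescaled sequence\<close>

lemma power4_le_powr:
  fixes t p :: real
  assumes "4 \<le> p"
  shows "t ^ 4 \<le> 1 + \<bar>t\<bar> powr p"
proof (cases "\<bar>t\<bar> \<le> 1")
  case True
  hence "\<bar>t\<bar> ^ 4 \<le> 1" by (intro power_le_one) auto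
  thus ?thesis using powr_ge_zero[of "\<bar>t\<bar>" p]
    by (simp add: power_even_abs del: powr_ge_zero)
next
  case False
  hence "\<bar>t\<bar> powr 4 \<le> \<bar>t\<bar> powr p" using assms by (intro powr_mono) auto
  moreover have "\<bar>t\<bar> powr 4 = t ^ 4"
    using False powr_realpow[of "\<bar>t\<bar>" 4] by (simp add: power_even_abs)
  ultimately show ?thesis by simp
qed

theorem theorem5:
  fixes f :: "real measure"
    and F :: "nat \<Rightarrow> (nat \<Rightarrow> real) measure"
    and p :: real
  assumes "real_distribution f"
    and "(\<integral>x. x\<^sup>2 \<partial>f) = 1"
    and "Kac_chaotic F f"
    and "\<And>N. N \<ge> 1 \<Longrightarrow> emeasure (F N) {origin_Rn N} = 0"
    and "p > 4"
    and "(SUP N\<in>{1..}. \<integral>\<^sup>+x. ennreal (\<bar>x 0\<bar> powr p) \<partial>F N) < \<infinity>"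
  shows "Kac_chaotic (\<lambda>N. rescaled_measure N (F N)) f"
proof -
  have F: "prob_measure_Rn N (F N)" "symmetric_Rn N (F N)" if "1 \<le> N" for N
    using assms(3) that by (auto simp: Kac_chaotic_def)
  have meas0: "(\<lambda>x. x 0) \<in> borel_measurable (F N)" if "1 \<le> N" for N
    using that F[OF that] measurable_component_singleton[of 0 "{..<N}" "\<lambda>_. borel :: real measure"]
    by (simp add: prob_measure_Rn_def cong: measurable_cong_sets)
  \<comment> \<open>The supremum lives in the extended nonnegative reals; being finite, it gives a
    real constant \<open>C\<close> that bounds all the Bochner integrals.\<close>
  define c where "c = (SUP N\<in>{1..}. \<integral>\<^sup>+x. ennreal (\<bar>x 0\<bar> powr p) \<partial>F N)"
  define C where "C = enn2real c"
  have bound: "integrable (F N) (\<lambda>x. \<bar>x 0\<bar> powr p) \<and> (\<integral>x. \<bar>x 0\<bar> powr p \<partial>F N) \<le> C"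
    if N: "1 \<le> N" for N
  proof -
    have m: "(\<lambda>x. \<bar>x 0\<bar> powr p) \<in> borel_measurable (F N)"
      using meas0[OF N] by measurable
    have le: "(\<integral>\<^sup>+x. ennreal (\<bar>x 0\<bar> powr p) \<partial>F N) \<le> c"
      unfolding c_def using N by (intro SUP_upper) auto
    have c: "c < \<infinity>" using assms(6) by (simp add: c_def)
    have "(\<integral>x. \<bar>x 0\<bar> powr p \<partial>F N) = enn2real (\<integral>\<^sup>+x. ennreal (\<bar>x 0\<bar> powr p) \<partial>F N)"
      by (intro integral_eq_nn_integral m) auto
    also have "\<dots> \<le> C"
      unfolding C_def using le c by (intro enn2real_mono) auto
    finally show ?thesis
      using le c m by (auto intro!: integrableI_nonneg)
  qed
  have fourth: "integrable (F N) (\<lambda>x. (x 0) ^ 4)" "(\<integral>x. (x 0) ^ 4 \<partial>F N) \<le> 1 + C" if N: "1 \<le> N" for N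
  proof -
    interpret prob_space "F N" using F[OF N] by (simp add: prob_measure_Rn_def)
    have le: "t ^ 4 \<le> 1 + \<bar>t\<bar> powr p" for t :: real
      using assms(5) by (intro power4_le_powr) auto
    have int: "integrable (F N) (\<lambda>x. 1 + \<bar>x 0\<bar> powr p)" using bound[OF N] by simp
    have m: "(\<lambda>x. (x 0) ^ 4) \<in> borel_measurable (F N)" using meas0[OF N] by measurable
    show i4: "integrable (F N) (\<lambda>x. (x 0) ^ 4)"
      by (rule Bochner_Integration.integrable_bound[OF int m]) (auto intro: order_trans[OF le])
    have "(\<integral>x. (x 0) ^ 4 \<partial>F N) \<le> (\<integral>x. 1 + \<bar>x 0\<bar> powr p \<partial>F N)"
      by (rule integral_mono[OF i4 int le])
    also have "\<dots> \<le> 1 + C" using bound[OF N] by (simp add: prob_space)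
    finally show "(\<integral>x. (x 0) ^ 4 \<partial>F N) \<le> 1 + C" .
  qed
  define V where "V N = (\<integral>x. ((\<Sum>i<N. (x i)\<^sup>2) / N - 1)\<^sup>2 \<partial>F N)" for N
  define B where "B N = (\<integral>x. (x 0)\<^sup>2 * (x 1)\<^sup>2 \<partial>F N)" for N
  define D where "D N = (\<integral>x. (x 0)\<^sup>2 \<partial>F N)" for N
  have D: "D \<longlonglongrightarrow> 1"
    using product_moment_tendsto[OF assms(1-3,5) _ bound, of 1] by (simp add: D_def[abs_def])
  have "{..<2} = {0, 1 :: nat}" by auto
  hence B: "B \<longlonglongrightarrow> 1"
    using product_moment_tendsto[OF assms(1-3,5) _ bound, of 2] by (simp add: B_def[abs_def])
  \<comment> \<open>The diagonal contribution disappears because fourth moments are bounded by 1 + C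
    uniformly in \<open>N\<close>.\<close>
  have "(\<lambda>N. (\<integral>x. (x 0) ^ 4 \<partial>F N) / N) \<longlonglongrightarrow> 0"
  proof (rule tendsto_sandwich)
    show "\<forall>\<^sub>F N in sequentially. 0 \<le> (\<integral>x. (x 0) ^ 4 \<partial>F N) / N" by simp
    show "\<forall>\<^sub>F N in sequentially. (\<integral>x. (x 0) ^ 4 \<partial>F N) / N \<le> (1 + C) / N"
      using eventually_ge_at_top[of 1]
      by eventually_elim (intro divide_right_mono fourth, auto)
  qed (auto intro: lim_const_over_n)
  \<comment> \<open>The limits combine to 0 + 1 - 2 + 1 = 0, so |x|^2/N tends to 1 in mean
    square.\<close>
  hence "(\<lambda>N. (\<integral>x. (x 0) ^ 4 \<partial>F N) / N + (1 - 1 / N) * B N - 2 * D N + 1)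
      \<longlonglongrightarrow> 0 + (1 - 0) * 1 - 2 * 1 + 1"
    by (intro tendsto_intros B D lim_const_over_n)
  moreover have "\<forall>\<^sub>F N in sequentially.
      (\<integral>x. (x 0) ^ 4 \<partial>F N) / N + (1 - 1 / N) * B N - 2 * D N + 1 = V N"
    using eventually_ge_at_top[of 1]
    by eventually_elim (simp only: mean_square_deviation(2)[OF F _ fourth(1)] V_def B_def D_def)
  ultimately have "V \<longlonglongrightarrow> 0 + (1 - 0) * 1 - 2 * 1 + 1"
    by (rule Lim_transform_eventually)
  hence V: "V \<longlonglongrightarrow> 0" by simp
  have "weak_conv_Rn k (\<lambda>N. marginal_Rn k (rescaled_measure N (F N))) (PiM {..<k} (\<lambda>_. f))"
    if k: "1 \<le> k" for k
    unfolding weak_conv_Rn_def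
  proof (intro allI impI, elim conjE)
    fix g :: "(nat \<Rightarrow> real) \<Rightarrow> real"
    assume cont: "continuous_map (product_topology (\<lambda>_. euclideanreal) {..<k}) euclideanreal g"
      and bdd: "bounded (g ` (PiE {..<k} (\<lambda>_. UNIV)))"
    let ?I = "\<lambda>N. \<integral>x. g x \<partial>marginal_Rn k (F N)"
    let ?J = "\<lambda>N. \<integral>x. g x \<partial>marginal_Rn k (rescaled_measure N (F N))"
    obtain M where M: "0 < M" "\<And>x. x \<in> PiE {..<k} (\<lambda>_. UNIV) \<Longrightarrow> \<bar>g x\<bar> \<le> M"
      using bdd unfolding bounded_pos by auto
    \<comment> \<open>The original marginals already converge by hypothesis, so it suffices that
      rescaling changes the integral of \<open>g\<close> by a vanishing amount.\<close>
    have "(\<lambda>N. ?J N - ?I N) \<longlonglongrightarrow> 0"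
    proof (rule tendstoI)
      fix \<epsilon> :: real assume \<epsilon>: "0 < \<epsilon>"
      \<comment> \<open>Chosen so that R^2 > 6Mk/\<epsilon>, which makes the limiting tail term
        2Mk/R^2 less than \<epsilon>/3; the added 1 makes the inequality strict and \<open>R\<close>
        positive.\<close>
      define R where "R = sqrt (6 * M * k / \<epsilon> + 1)"
      have pos: "0 < 6 * M * k / \<epsilon> + 1" using M \<epsilon> by (intro add_nonneg_pos) auto
      have R: "0 < R" "R\<^sup>2 = 6 * M * k / \<epsilon> + 1" using pos by (simp_all add: R_def)
      have "2 * M * k < \<epsilon> / 3 * R\<^sup>2" using \<epsilon> unfolding R(2) by (simp add: field_simps)
      \<comment> \<open>Stated for every \<open>d\<close>, as \<open>d\<close> comes from uniform
        continuity on the box of side \<open>R\<close> and so is obtained only after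
        \<open>R\<close>. The 0 and the 1 are the limits of \<open>V\<close> and
        \<open>D\<close>.\<close>
      hence small: "2 * M * (0 / d\<^sup>2 + real k * 1 / R\<^sup>2) < \<epsilon> / 3" for d :: real
        using R(1) by (simp add: pos_divide_less_eq)
      obtain d where d: "0 < d"
        "\<And>s x. \<bar>s - 1\<bar> < d \<Longrightarrow> (\<And>i. i < k \<Longrightarrow> \<bar>x i\<bar> \<le> R) \<Longrightarrow>
           \<bar>g (\<lambda>i\<in>{..<k}. x i / sqrt s) - g (restrict x {..<k})\<bar> < \<epsilon> / 3"
        using uniform_continuity_dilation[OF cont, of "\<epsilon> / 3" R] \<epsilon> by auto
      have "(\<lambda>N. \<epsilon> / 3 + 2 * M * (V N / d\<^sup>2 + k * D N / R\<^sup>2)) \<longlonglongrightarrow>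
          \<epsilon> / 3 + 2 * M * (0 / d\<^sup>2 + real k * 1 / R\<^sup>2)"
        using d(1) R(1) by (intro tendsto_add tendsto_mult tendsto_divide tendsto_const V D) auto
      moreover have "\<epsilon> / 3 + 2 * M * (0 / d\<^sup>2 + real k * 1 / R\<^sup>2) < \<epsilon>"
        using small[of d] \<epsilon> by linarith
      ultimately have "\<forall>\<^sub>F N in sequentially. \<epsilon> / 3 + 2 * M * (V N / d\<^sup>2 + k * D N / R\<^sup>2) < \<epsilon>"
        by (rule order_tendstoD(2))
      thus "\<forall>\<^sub>F N in sequentially. dist (?J N - ?I N) 0 < \<epsilon>"
        using eventually_ge_at_top[of k]
      proof eventually_elim
        case (elim N)
        hence N: "1 \<le> N" using k by simp
        have "\<bar>?J N - ?I N\<bar> \<le> \<epsilon> / 3 + 2 * M * (V N / d\<^sup>2 + k * D N / R\<^sup>2)"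
          unfolding V_def D_def
          using \<epsilon> by (intro rescaled_integral_diff_le F N fourth(1) cont M(2) d R(1) elim(2)) auto
        thus ?case using elim(1) by (simp add: dist_real_def)
      qed
    qed
    moreover have "?I \<longlonglongrightarrow> (\<integral>x. g x \<partial>PiM {..<k} (\<lambda>_. f))"
      using assms(3) k cont bdd unfolding Kac_chaotic_def weak_conv_Rn_def by blast
    ultimately have "(\<lambda>N. (?J N - ?I N) + ?I N) \<longlonglongrightarrow> 0 + (\<integral>x. g x \<partial>PiM {..<k} (\<lambda>_. f))"
      by (rule tendsto_add)
    thus "?J \<longlonglongrightarrow> (\<integral>x. g x \<partial>PiM {..<k} (\<lambda>_. f))" by simp
  qed
  thus ?thesis
    unfolding Kac_chaotic_def using symmetric_Rn_rescaled[OF F] by blast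
qed

end
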